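(* Let $N\ge 1$, $\Delta t>0$, $B\ge 0$, and for each $i\in\{1,\dots,N\}$ let $L_i>0$, $x_i\in[0,1]$, $\tau_i\in(0,1)$, and let $A_i:[0,1]\to\mathbb{R}$ be a function that is continuously differentiable, strictly increasing and strictly concave on $[\tau_i,1]$. Put $\tilde{x}_i=\max\{x_i,\tau_i\}$ and consider the optimization problem $$ \begin{aligned} \operatorname*{minimize}_{\{y_i\}}\quad & -\sum_{i=1}^{N} A_i(y_i)\\ \text{subject to}\quad & \sum_{i=1}^{N}\frac{L_i(y_i-x_i)}{\Delta t}\le B,\\ & \tilde{x}_i\le y_i\le 1,\quad \forall i\in\{1,\dots,N\}. \end{aligned} $$ Suppose that $$B\ \ge\ B_{\min}:=\frac{1}{\Delta t}\sum_{i=1}^{N}L_i\,[\tau_i-x_i]^+ .$$ For $\lambda\ge 0$ set $s_i(\lambda)=\lambda L_i/\Delta t$ and $$ W_i(\lambda)=\begin{cases} 1, & s_i(\lambda)\le A_i'(1),\\ (A_i')^{-1}\bigl(s_i(\lambda)\bigr), & A_i'(1)<s_i(\lambda)<A_i'(\tau_i),\\ \tau_i, & s_i(\lambda)\ge A_i'(\tau_i). \end{cases} $$ Then the primal optimum of the problem is $$ y_i^\star=\max\{x_i,W_i(\lambda^\star)\},\qquad b_i^\star=\frac{y_i^\star-x_i}{\Delta t},\qquad i=1,\dots,N, $$ where $\lambda^\star\ge 0$ is a dual-optimal variable associated with the constraint $\sum_{i} L_i(y_i-x_i)/\Delta t\le B$. When this constraint binds, $\lambda^\star$ can be chosen to satisfy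 $$\sum_{i=1}^{N}\frac{L_i(y_i^\star-x_i)}{\Delta t}=B .$$
   Context: Notation: $[a]^+=\max\{a,0\}$. The derivatives $A_i'$ at $\tau_i$ and $1$ are those of $A_i$ as a function on the interval $[\tau_i,1]$ (one-sided at the endpoints). Since $A_i$ is strictly concave and continuously differentiable on $[\tau_i,1]$, $A_i'$ is continuous and strictly decreasing there, and $(A_i')^{-1}$ denotes the inverse of $A_i'$ restricted to $[\tau_i,1]$, defined on $[A_i'(1),A_i'(\tau_i)]$. Interpretation: $N$ users share a backhaul of bandwidth $B$ (bits/s) during a time slot of duration $\Delta t$; $L_i$ is the cache size of user $i$ in bits, $x_i$ is the fraction of the cache already received at the beginning of the slot, $y_i=x_i+b_i\Delta t$ is the fraction received at the end of the slot, $b_i\ge 0$ is the normalized delivery rate, and $A_i(y)$ is the accuracy of user $i$ when a fraction $y$ of the cache has been received. Through $b_i=(y_i-x_i)/\Delta t$, the problem in the claim is equivalent to maximizing $\sum_i[A_i(y_i)-A_i(x_i)]$ over $\{b_i\}$ subject to $\sum_i L_ib_i\le B$, $b_i\ge 0$, $\tau_i\le y_i\le 1$; $b_i^\star$ is the corresponding optimal rate. "Dual-optimal variable" means an optimal Lagrange multiplier $\lambda\ge 0$ (in the sense of the Karush–Kuhn–Tucker conditions / Lagrangian duality) for the single coupling constraint $\sum_i L_i(y_i-x_i)/\Delta t\le B$. *)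

theory Defs
  imports "HOL-Analysis.Analysis"
begin

text \<open>
  Users are indexed by a finite type \<open>'n\<close>, so that \<open>N = CARD('n) \<ge> 1\<close>.
  An accuracy function is a total function \<open>real \<Rightarrow> real\<close>; only its values on
  \<open>{0..1}\<close> are ever used.
\<close>

definition strictly_concave_on :: "real set \<Rightarrow> (real \<Rightarrow> real) \<Rightarrow> bool" where
  "strictly_concave_on S f \<longleftrightarrow> convex S \<and>
     (\<forall>u\<in>S. \<forall>v\<in>S. \<forall>t. u \<noteq> v \<and> 0 < t \<and> t < 1 \<longrightarrow>
        (1 - t) * f u + t * f v < f ((1 - t) * u + t * v))"

definition x_tilde :: "real ^ 'n \<Rightarrow> real ^ 'n \<Rightarrow> real ^ 'n" where
  "x_tilde x \<tau> = (\<chi> i. max (x $ i) (\<tau> $ i))"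

definition backhaul_load :: "real \<Rightarrow> real ^ 'n \<Rightarrow> real ^ 'n \<Rightarrow> real ^ 'n \<Rightarrow> real" where
  "backhaul_load dt L x y = (\<Sum>i\<in>UNIV. L $ i * (y $ i - x $ i) / dt)"

definition B_min :: "real \<Rightarrow> real ^ 'n \<Rightarrow> real ^ 'n \<Rightarrow> real ^ 'n \<Rightarrow> real" where
  "B_min dt L x \<tau> = 1 / dt * (\<Sum>i\<in>UNIV. L $ i * max (\<tau> $ i - x $ i) 0)"

definition primal_objective :: "('n \<Rightarrow> real \<Rightarrow> real) \<Rightarrow> real ^ 'n \<Rightarrow> real" where
  "primal_objective A y = - (\<Sum>i\<in>UNIV. A i (y $ i))"

definition in_box :: "real ^ 'n \<Rightarrow> real ^ 'n \<Rightarrow> real ^ 'n \<Rightarrow> bool" where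
  "in_box x \<tau> y \<longleftrightarrow> (\<forall>i. x_tilde x \<tau> $ i \<le> y $ i \<and> y $ i \<le> 1)"

definition primal_feasible ::
  "real \<Rightarrow> real \<Rightarrow> real ^ 'n \<Rightarrow> real ^ 'n \<Rightarrow> real ^ 'n \<Rightarrow> real ^ 'n \<Rightarrow> bool" where
  "primal_feasible dt B L x \<tau> y \<longleftrightarrow> backhaul_load dt L x y \<le> B \<and> in_box x \<tau> y"

definition primal_optimal ::
  "real \<Rightarrow> real \<Rightarrow> real ^ 'n \<Rightarrow> real ^ 'n \<Rightarrow> real ^ 'n \<Rightarrow> ('n \<Rightarrow> real \<Rightarrow> real) \<Rightarrow>
    real ^ 'n \<Rightarrow> bool" where
  "primal_optimal dt B L x \<tau> A y \<longleftrightarrow>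
     is_arg_min (primal_objective A) (primal_feasible dt B L x \<tau>) y"

text \<open>
  Only the coupling constraint is dualized; the box constraints remain the domain over
  which the Lagrangian is minimized. The infimum in \<open>dual_function\<close> is one of real numbers,
  hence meaningful only when the Lagrangian is bounded below on the (nonempty) box; this
  holds when each \<open>A i\<close> is continuous on \<open>{\<tau> $ i..1}\<close>, the box being compact.
\<close>

definition lagrangian ::
  "real \<Rightarrow> real \<Rightarrow> real ^ 'n \<Rightarrow> real ^ 'n \<Rightarrow> ('n \<Rightarrow> real \<Rightarrow> real) \<Rightarrow> real ^ 'n \<Rightarrow> real \<Rightarrow> real" where
  "lagrangian dt B L x A y lam = primal_objective A y + lam * (backhaul_load dt L x y - B)"

definition dual_function ::
  "real \<Rightarrow> real \<Rightarrow> real ^ 'n \<Rightarrow> real ^ 'n \<Rightarrow> real ^ 'n \<Rightarrow> ('n \<Rightarrow> real \<Rightarrow> real) \<Rightarrow> real \<Rightarrow> real" where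
  "dual_function dt B L x \<tau> A lam = (INF y\<in>{y. in_box x \<tau> y}. lagrangian dt B L x A y lam)"

definition dual_optimal ::
  "real \<Rightarrow> real \<Rightarrow> real ^ 'n \<Rightarrow> real ^ 'n \<Rightarrow> real ^ 'n \<Rightarrow> ('n \<Rightarrow> real \<Rightarrow> real) \<Rightarrow> real \<Rightarrow> bool" where
  "dual_optimal dt B L x \<tau> A lam \<longleftrightarrow>
     is_arg_max (dual_function dt B L x \<tau> A) (\<lambda>l. 0 \<le> l) lam"

text \<open>
  The same problem in terms of the delivery rates \<open>b = (y - x) / dt\<close>.
\<close>

definition rate_objective ::
  "real \<Rightarrow> real ^ 'n \<Rightarrow> ('n \<Rightarrow> real \<Rightarrow> real) \<Rightarrow> real ^ 'n \<Rightarrow> real" where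
  "rate_objective dt x A b = (\<Sum>i\<in>UNIV. A i (x $ i + b $ i * dt) - A i (x $ i))"

definition rate_feasible ::
  "real \<Rightarrow> real \<Rightarrow> real ^ 'n \<Rightarrow> real ^ 'n \<Rightarrow> real ^ 'n \<Rightarrow> real ^ 'n \<Rightarrow> bool" where
  "rate_feasible dt B L x \<tau> b \<longleftrightarrow>
     (\<Sum>i\<in>UNIV. L $ i * b $ i) \<le> B \<and>
     (\<forall>i. 0 \<le> b $ i \<and> \<tau> $ i \<le> x $ i + b $ i * dt \<and> x $ i + b $ i * dt \<le> 1)"

definition rate_optimal ::
  "real \<Rightarrow> real \<Rightarrow> real ^ 'n \<Rightarrow> real ^ 'n \<Rightarrow> real ^ 'n \<Rightarrow> ('n \<Rightarrow> real \<Rightarrow> real) \<Rightarrow>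
    real ^ 'n \<Rightarrow> bool" where
  "rate_optimal dt B L x \<tau> A b \<longleftrightarrow>
     is_arg_max (rate_objective dt x A) (rate_feasible dt B L x \<tau>) b"

text \<open>
  Below, \<open>A'\<close> is the family of derivatives of the accuracy functions, \<open>A' i\<close> being
  relevant on \<open>{\<tau> $ i..1}\<close> only; its inverse is that of the restriction to this interval.
\<close>

definition water_level ::
  "real \<Rightarrow> real ^ 'n \<Rightarrow> real ^ 'n \<Rightarrow> ('n \<Rightarrow> real \<Rightarrow> real) \<Rightarrow> real \<Rightarrow> 'n \<Rightarrow> real" where
  "water_level dt L \<tau> A' lam i =
     (let s = lam * L $ i / dt in
        if s \<le> A' i 1 then 1
        else if s < A' i (\<tau> $ i) then the_inv_into {\<tau> $ i..1} (A' i) s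
        else \<tau> $ i)"

definition y_star ::
  "real \<Rightarrow> real ^ 'n \<Rightarrow> real ^ 'n \<Rightarrow> real ^ 'n \<Rightarrow> ('n \<Rightarrow> real \<Rightarrow> real) \<Rightarrow> real \<Rightarrow> real ^ 'n" where
  "y_star dt L x \<tau> A' lam = (\<chi> i. max (x $ i) (water_level dt L \<tau> A' lam i))"

definition b_star ::
  "real \<Rightarrow> real ^ 'n \<Rightarrow> real ^ 'n \<Rightarrow> real ^ 'n \<Rightarrow> ('n \<Rightarrow> real \<Rightarrow> real) \<Rightarrow> real \<Rightarrow> real ^ 'n" where
  "b_star dt L x \<tau> A' lam = (\<chi> i. (y_star dt L x \<tau> A' lam $ i - x $ i) / dt)"

end

theory Submission
  imports Defs
begin

text \<open>
  Strict concavity makes \<^term>\<open>y_star dt L x \<tau> A' lam\<close> the unique minimizer of the Lagrangian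
  over the box, for every multiplier \<open>lam \<ge> 0\<close>. Its load is continuous in \<open>lam\<close> and, for large
  \<open>lam\<close>, equals \<open>B_min \<le> B\<close>; so either \<open>lam = 0\<close> already respects the budget or the intermediate
  value theorem yields a multiplier whose load is exactly \<open>B\<close>. Complementary slackness gives
  strong duality (also for \<open>B = B_min\<close>, where Slater's condition fails), and then the primal
  optimum minimizes the Lagrangian for every dual-optimal multiplier, hence is \<open>y_star\<close>.
\<close>

section \<open>Tangent inequalities for strictly concave functions\<close>

text \<open>By concavity, the difference quotient of \<open>f\<close> along the segment from
  \<open>w\<close> to \<open>y\<close> is at least \<open>f y - f w\<close>, and it tends to
  \<open>d * (y - w)\<close> as \<open>t\<close> goes to 0. Only a derivative within
  \<open>S\<close> is required, so endpoints of an interval are covered.\<close>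

lemma strictly_concave_on_le_tangent:
  fixes f :: "real \<Rightarrow> real"
  assumes conc: "strictly_concave_on S f" and w: "w \<in> S" and y: "y \<in> S"
    and der: "(f has_real_derivative d) (at w within S)"
  shows "f y \<le> f w + d * (y - w)"
proof (cases "y = w")
  case False
  define g where "g t = w + t * (y - w)" for t
  have g_in: "g t \<in> S" if "t \<in> {0..1}" for t
  proof -
    have "(1 - t) *\<^sub>R w + t *\<^sub>R y \<in> S"
      using conc w y that unfolding strictly_concave_on_def convex_alt by auto
    then show ?thesis by (simp add: g_def algebra_simps)
  qed
  have dg: "(g has_real_derivative (y - w)) (at 0 within {0..1})"
    unfolding g_def by (auto intro!: derivative_eq_intros)
  have "(f has_real_derivative d) (at (g 0) within g ` {0..1})"
    using has_field_derivative_subset[OF der, of "g ` {0..1}"] g_in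
    by (auto simp: image_subset_iff g_def)
  from DERIV_image_chain[OF this dg]
  have "((\<lambda>t. (f (g t) - f w) / t) \<longlongrightarrow> d * (y - w)) (at 0 within {0..1})"
    by (simp add: has_field_derivative_iff o_def g_def)
  moreover have "\<forall>\<^sub>F t in at 0 within {0..1}. f y - f w \<le> (f (g t) - f w) / t"
  proof -
    have "f y - f w \<le> (f (g t) - f w) / t" if t: "0 < t" "t < 1" for t
    proof -
      have "(1 - t) * f w + t * f y < f ((1 - t) * w + t * y)"
        using conc w y False t unfolding strictly_concave_on_def by auto
      moreover have "(1 - t) * w + t * y = g t" by (simp add: g_def algebra_simps)
      ultimately have "(1 - t) * f w + t * f y < f (g t)" by simp
      then show ?thesis using t by (simp add: field_simps)
    qed
    moreover have "\<forall>\<^sub>F t in at 0 within {0..1::real}. t < 1"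
      by (rule order_tendstoD(2)[OF tendsto_ident_at]) simp
    ultimately show ?thesis
      by (auto simp: eventually_at_filter elim!: eventually_mono)
  qed
  ultimately have "f y - f w \<le> d * (y - w)"
    by (rule tendsto_lowerbound) (simp add: trivial_limit_within islimpt_Icc)
  then show ?thesis by simp
qed simp

text \<open>Passing to the limit loses strictness. It is recovered at the midpoint \<open>m\<close>:
  strict concavity there, combined with the weak tangent bound at \<open>m\<close>, gives the strict
  bound at \<open>y\<close>.\<close>

lemma strictly_concave_on_less_tangent:
  fixes f :: "real \<Rightarrow> real"
  assumes conc: "strictly_concave_on S f" and w: "w \<in> S" and y: "y \<in> S" and "y \<noteq> w"
    and der: "(f has_real_derivative d) (at w within S)"
  shows "f y < f w + d * (y - w)"
proof -
  define m where "m = (w + y) / 2"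
  have m: "(1 - 1/2) * w + 1/2 * y = m" by (simp add: m_def field_simps)
  have "(1 - 1/2) * f w + 1/2 * f y < f ((1 - 1/2) * w + 1/2 * y)"
    using conc[unfolded strictly_concave_on_def, THEN conjunct2, rule_format, of w y "1/2"] w y \<open>y \<noteq> w\<close>
    by simp
  then have mid: "(f w + f y) / 2 < f m" unfolding m by (simp add: field_simps)
  have "(1 - 1/2) *\<^sub>R w + (1/2) *\<^sub>R y \<in> S"
    by (rule convexD_alt) (use conc w y in \<open>auto simp: strictly_concave_on_def\<close>)
  then have "m \<in> S" using m by simp
  from strictly_concave_on_le_tangent[OF conc w this der]
  have "f m \<le> f w + d * (y - w) / 2" by (simp add: m_def field_simps)
  with mid show ?thesis by (simp add: field_simps)
qed

text \<open>Adding the strict tangent inequalities at \<open>u\<close> and at \<open>v\<close>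
  cancels the values of \<open>f\<close>.\<close>

lemma strictly_concave_on_deriv_less:
  fixes f f' :: "real \<Rightarrow> real"
  assumes conc: "strictly_concave_on S f"
    and der: "\<And>u. u \<in> S \<Longrightarrow> (f has_real_derivative f' u) (at u within S)"
    and u: "u \<in> S" and v: "v \<in> S" and "u < v"
  shows "f' v < f' u"
proof -
  have "f v < f u + f' u * (v - u)" "f u < f v + f' v * (u - v)"
    using strictly_concave_on_less_tangent[OF conc] der u v \<open>u < v\<close> by auto
  then have "0 < (f' u - f' v) * (v - u)" by (simp add: algebra_simps)
  with \<open>u < v\<close> show ?thesis by (simp add: zero_less_mult_iff)
qed

section \<open>The water level and its dependence on the multiplier\<close>

locale caching_problem =
  fixes dt B :: real
    and L x \<tau> :: "real ^ 'n"
    and A A' :: "'n \<Rightarrow> real \<Rightarrow> real"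
  assumes dt_pos: "dt > 0"
    and L_pos: "\<And>i. L $ i > 0"
    and x_le: "\<And>i. x $ i \<le> 1"
    and tau_less: "\<And>i. \<tau> $ i < 1"
    and A_deriv: "\<And>i u. u \<in> {\<tau> $ i..1} \<Longrightarrow>
          (A i has_real_derivative A' i u) (at u within {\<tau> $ i..1})"
    and A_C1: "\<And>i. continuous_on {\<tau> $ i..1} (A' i)"
    and A_conc: "\<And>i. strictly_concave_on {\<tau> $ i..1} (A i)"
    and B_ge: "B \<ge> B_min dt L x \<tau>"
begin

abbreviation "ystar \<equiv> y_star dt L x \<tau> A'"
abbreviation "water \<equiv> water_level dt L \<tau> A'"
abbreviation "load \<equiv> backhaul_load dt L x"
abbreviation "lagr \<equiv> lagrangian dt B L x A"
abbreviation "dual \<equiv> dual_function dt B L x \<tau> A"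

lemma A'_less: "\<lbrakk>u \<in> {\<tau> $ i..1}; v \<in> {\<tau> $ i..1}; u < v\<rbrakk> \<Longrightarrow> A' i v < A' i u"
  using strictly_concave_on_deriv_less[OF A_conc A_deriv] by blast

lemma inj_A': "inj_on (A' i) {\<tau> $ i..1}"
proof (rule inj_onI, rule ccontr)
  fix u v assume *: "u \<in> {\<tau> $ i..1}" "v \<in> {\<tau> $ i..1}" "A' i u = A' i v" "u \<noteq> v"
  then show False using A'_less[of u i v] A'_less[of v i u] by (cases "u < v") auto
qed

lemma A'_surj:
  assumes "A' i 1 \<le> s" "s \<le> A' i (\<tau> $ i)"
  shows "s \<in> A' i ` {\<tau> $ i..1}"
proof -
  obtain u where "\<tau> $ i \<le> u" "u \<le> 1" "A' i u = s"
    using IVT2'[OF assms less_imp_le[OF tau_less] A_C1] by blast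
  then show ?thesis by (intro image_eqI[of _ _ u]) auto
qed

text \<open>Clamping \<open>s\<close> to the range of \<open>A' i\<close> merges the three cases into one continuous formula.\<close>

lemma water_level_eq:
  "water lam i =
     the_inv_into {\<tau> $ i..1} (A' i) (max (A' i 1) (min (lam * L $ i / dt) (A' i (\<tau> $ i))))"
proof -
  have inv: "the_inv_into {\<tau> $ i..1} (A' i) (A' i u) = u" if "u \<in> {\<tau> $ i..1}" for u
    using the_inv_into_f_f[OF inj_A' that] .
  have "A' i 1 < A' i (\<tau> $ i)" using A'_less tau_less[of i] by simp
  with inv[of 1] inv[of "\<tau> $ i"] tau_less[of i] show ?thesis
    by (auto simp: water_level_def Let_def max_def min_def)
qed

lemma water_level_in: "water lam i \<in> {\<tau> $ i..1}"
proof -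
  have "A' i 1 < A' i (\<tau> $ i)" using A'_less tau_less[of i] by simp
  then have "max (A' i 1) (min (lam * L $ i / dt) (A' i (\<tau> $ i))) \<in> A' i ` {\<tau> $ i..1}"
    by (intro A'_surj) auto
  then show ?thesis unfolding water_level_eq by (intro the_inv_into_into[OF inj_A']) auto
qed

text \<open>The clamped argument always lies in the range of \<open>A' i\<close>, and the inverse of
  a continuous injection on a compact interval is continuous.\<close>

lemma continuous_water_level: "continuous_on UNIV (\<lambda>lam. water lam i)"
proof -
  let ?c = "\<lambda>lam. max (A' i 1) (min (lam * L $ i / dt) (A' i (\<tau> $ i)))"
  have "A' i 1 < A' i (\<tau> $ i)" using A'_less tau_less[of i] by simp
  then have "?c ` UNIV \<subseteq> A' i ` {\<tau> $ i..1}" by (intro image_subsetI A'_surj) auto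
  moreover have "continuous_on (A' i ` {\<tau> $ i..1}) (the_inv_into {\<tau> $ i..1} (A' i))"
    by (rule continuous_on_inv[OF A_C1]) (auto simp: the_inv_into_f_f[OF inj_A'])
  moreover have "continuous_on UNIV ?c"
    using dt_pos by (intro continuous_intros) auto
  ultimately show ?thesis
    unfolding water_level_eq by (rule continuous_on_compose2[rotated 2])
qed

lemma continuous_load: "continuous_on UNIV (\<lambda>lam. load (ystar lam))"
proof -
  have "continuous_on UNIV (\<lambda>lam. \<Sum>i\<in>UNIV. L $ i * (max (x $ i) (water lam i) - x $ i) / dt)"
    using dt_pos by (intro continuous_intros continuous_water_level) simp
  then show ?thesis by (simp add: backhaul_load_def y_star_def)
qed

section \<open>The unique minimizer of the Lagrangian over the box\<close>

lemma y_star_nth: "ystar lam $ i = max (x $ i) (water lam i)"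
  by (simp add: y_star_def)

lemma y_star_in_box: "in_box x \<tau> (ystar lam)"
proof -
  have "\<tau> $ i \<le> water lam i \<and> water lam i \<le> 1" for i
    using water_level_in[of lam i] by simp
  then show ?thesis
    using x_le by (auto simp: in_box_def x_tilde_def y_star_nth intro: max.coboundedI2)
qed

text \<open>Variational inequality of user \<open>i\<close>: at \<open>ystar lam $ i\<close>, the
  function \<open>A i u - lam * L $ i / dt * u\<close> has nonpositive slope in every admissible
  direction. The product form treats stationarity and both active bounds at once.\<close>

lemma y_star_first_order:
  assumes "x $ i \<le> u" "\<tau> $ i \<le> u" "u \<le> 1"
  shows "(A' i (ystar lam $ i) - lam * L $ i / dt) * (u - ystar lam $ i) \<le> 0"
proof -
  define s where "s = lam * L $ i / dt"
  let ?W = "water lam i"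
  have W: "?W \<in> {\<tau> $ i..1}" by (rule water_level_in)
  have mono: "A' i v \<le> A' i w" if "w \<in> {\<tau> $ i..1}" "v \<in> {\<tau> $ i..1}" "w \<le> v" for v w
    using A'_less[of w i v] that by (cases "v = w") auto
  consider (top) "s \<le> A' i 1" "?W = 1"
    | (mid) "A' i ?W = s"
    | (bot) "A' i (\<tau> $ i) \<le> s" "?W = \<tau> $ i"
  proof (cases "s \<le> A' i 1")
    case True
    then show ?thesis using top by (auto simp: water_level_def s_def)
  next
    case *: False
    show ?thesis
    proof (cases "s < A' i (\<tau> $ i)")
      case True
      with * have "?W = the_inv_into {\<tau> $ i..1} (A' i) s"
        by (auto simp: water_level_def s_def)
      with * True show ?thesis
        using mid f_the_inv_into_f[OF inj_A' A'_surj[of i s]] by simp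
    next
      case False
      then show ?thesis using bot * by (auto simp: water_level_def s_def)
    qed
  qed
  then have "(A' i (max (x $ i) ?W) - s) * (u - max (x $ i) ?W) \<le> 0"
  proof cases
    case top
    then show ?thesis using assms x_le[of i] by (auto simp: max_def intro: mult_nonneg_nonpos)
  next
    case mid
    show ?thesis
    proof (cases "x $ i \<le> ?W")
      \<comment> \<open>The user already holds more than the water level, so the lower bound
        \<open>x $ i\<close> is active; the marginal accuracy there is at most \<open>s\<close>, and
        every admissible \<open>u\<close> lies to its right.\<close>
      case False
      then have "A' i (x $ i) \<le> s" using mono[of ?W "x $ i"] W x_le[of i] mid by auto
      then show ?thesis using False assms by (auto simp: max_def intro: mult_nonpos_nonneg)
    qed (simp add: mid max_def)
  next
    case bot
    then have "A' i (max (x $ i) (\<tau> $ i)) \<le> s"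
      using mono[of "\<tau> $ i" "max (x $ i) (\<tau> $ i)"] tau_less[of i] x_le[of i] by auto
    then show ?thesis using bot assms by (auto intro: mult_nonpos_nonneg)
  qed
  then show ?thesis by (simp add: s_def y_star_nth)
qed

text \<open>Apart from the constant \<open>lam * B\<close>, the Lagrangian is a sum of one-user
  terms, so its minimization decouples.\<close>

lemma lagrangian_eq:
  "lagr y lam =
     (\<Sum>i\<in>UNIV. lam * L $ i / dt * (y $ i - x $ i) - A i (y $ i)) - lam * B"
proof -
  have "lam * load y = (\<Sum>i\<in>UNIV. lam * L $ i / dt * (y $ i - x $ i))"
    by (simp add: backhaul_load_def sum_distrib_left mult.assoc)
  then show ?thesis
    by (simp add: lagrangian_def primal_objective_def sum_subtractf right_diff_distrib[of lam "load y"])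
qed

text \<open>In each coordinate where \<open>y\<close> differs from \<open>ystar lam\<close>, the
  strict tangent bound and the first-order condition give a strictly larger term; one such
  coordinate suffices.\<close>

lemma lagrangian_y_star_less:
  assumes y: "in_box x \<tau> y" and neq: "y \<noteq> ystar lam"
  shows "lagr (ystar lam) lam < lagr y lam"
proof -
  let ?w = "ystar lam"
  define s where "s i = lam * L $ i / dt" for i
  have box: "x $ i \<le> y $ i" "\<tau> $ i \<le> y $ i" "y $ i \<le> 1" for i
    using y by (auto simp: in_box_def x_tilde_def)
  have w: "?w $ i \<in> {\<tau> $ i..1}" for i
    using y_star_in_box[of lam] by (auto simp: in_box_def x_tilde_def)
  have strict: "s i * (?w $ i - x $ i) - A i (?w $ i) < s i * (y $ i - x $ i) - A i (y $ i)"
    if "y $ i \<noteq> ?w $ i" for i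
  proof -
    have "A i (y $ i) < A i (?w $ i) + A' i (?w $ i) * (y $ i - ?w $ i)"
      using strictly_concave_on_less_tangent[OF A_conc w _ that A_deriv[OF w]] box by simp
    with y_star_first_order[OF box, of i lam] show ?thesis
      unfolding s_def[symmetric] by (simp add: algebra_simps)
  qed
  obtain k where k: "y $ k \<noteq> ?w $ k" using neq by (auto simp: vec_eq_iff)
  have "(\<Sum>i\<in>UNIV. s i * (?w $ i - x $ i) - A i (?w $ i))
      < (\<Sum>i\<in>UNIV. s i * (y $ i - x $ i) - A i (y $ i))"
  proof (rule sum_strict_mono_ex1)
    show "\<forall>i\<in>UNIV. s i * (?w $ i - x $ i) - A i (?w $ i) \<le> s i * (y $ i - x $ i) - A i (y $ i)"
      using strict by (metis less_eq_real_def)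
  qed (use strict[OF k] in auto)
  then show ?thesis by (simp add: lagrangian_eq s_def)
qed

lemma lagrangian_y_star_le: "in_box x \<tau> y \<Longrightarrow> lagr (ystar lam) lam \<le> lagr y lam"
  using lagrangian_y_star_less[of y lam] by (cases "y = ystar lam") auto

section \<open>Duality and complementary slackness\<close>

lemma dual_function_eq: "dual lam = lagr (ystar lam) lam"
  unfolding dual_function_def
proof (rule cInf_eq_minimum)
  show "lagr (ystar lam) lam \<in> (\<lambda>y. lagr y lam) ` {y. in_box x \<tau> y}"
    using y_star_in_box by simp
qed (auto simp: lagrangian_y_star_le)

lemma dual_function_le: "in_box x \<tau> y \<Longrightarrow> dual lam \<le> lagr y lam"
  by (simp add: dual_function_eq lagrangian_y_star_le)

lemma lagrangian_le_objective:
  assumes "primal_feasible dt B L x \<tau> y" "lam \<ge> 0"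
  shows "lagr y lam \<le> primal_objective A y"
  using assms by (simp add: lagrangian_def primal_feasible_def mult_nonneg_nonpos)

lemma exists_complementary_multiplier:
  obtains lam where "lam \<ge> 0" "load (ystar lam) \<le> B" "lam * (load (ystar lam) - B) = 0"
proof (cases "load (ystar 0) \<le> B")
  case True
  then show ?thesis using that[of 0] by simp
next
  case False
  \<comment> \<open>At the price \<open>M\<close> the marginal cost \<open>M * L $ i / dt\<close>
    reaches \<open>A' i (\<tau> $ i)\<close> for all users simultaneously. The absolute values let
    the sum dominate each summand and make \<open>M\<close> nonnegative.\<close>
  define M where "M = (\<Sum>i\<in>UNIV. \<bar>A' i (\<tau> $ i) * dt / L $ i\<bar>)"
  have M: "0 \<le> M" by (simp add: M_def sum_nonneg)
  have "water M i = \<tau> $ i" for i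
  proof -
    have "A' i (\<tau> $ i) * dt / L $ i \<le> \<bar>A' i (\<tau> $ i) * dt / L $ i\<bar>"
      by (rule abs_ge_self)
    also have "\<dots> \<le> M"
      unfolding M_def by (rule member_le_sum[of i UNIV "\<lambda>i. \<bar>A' i (\<tau> $ i) * dt / L $ i\<bar>"]) auto
    finally have "A' i (\<tau> $ i) \<le> M * L $ i / dt"
      using dt_pos L_pos[of i] by (simp add: field_simps)
    moreover have "A' i 1 < A' i (\<tau> $ i)" using A'_less tau_less[of i] by simp
    ultimately show ?thesis by (simp add: water_level_def)
  qed
  then have "load (ystar M) = B_min dt L x \<tau>"
    by (auto simp: backhaul_load_def B_min_def y_star_nth sum_distrib_left max_def intro!: sum.cong)
  \<comment> \<open>The load exceeds \<open>B\<close> at 0 and is \<open>B_min\<close>, hence at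
    most \<open>B\<close>, at \<open>M\<close>.\<close>
  then obtain lam where "0 \<le> lam" "load (ystar lam) = B"
    using IVT2'[of "\<lambda>l. load (ystar l)" M B 0] B_ge False M
      continuous_on_subset[OF continuous_load] by auto
  then show ?thesis using that by simp
qed

text \<open>Complementary slackness makes the Lagrangian at \<open>ystar lam\<close> equal to the
  objective, which closes the duality gap. The second equivalence turns dual optimality of any other
  \<open>mu\<close> into attainment of the primal value.\<close>

lemma complementary_multiplier:
  assumes lam: "lam \<ge> 0" and le: "load (ystar lam) \<le> B"
    and compl: "lam * (load (ystar lam) - B) = 0"
  shows "primal_optimal dt B L x \<tau> A y \<longleftrightarrow> y = ystar lam"
    and "dual_optimal dt B L x \<tau> A mu \<longleftrightarrow> mu \<ge> 0 \<and> dual mu = primal_objective A (ystar lam)"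
proof -
  have feas: "primal_feasible dt B L x \<tau> (ystar lam)"
    using le y_star_in_box by (simp add: primal_feasible_def)
  have val: "lagr (ystar lam) lam = primal_objective A (ystar lam)"
    using compl by (simp add: lagrangian_def)
  have less: "primal_objective A (ystar lam) < primal_objective A z"
    if "primal_feasible dt B L x \<tau> z" "z \<noteq> ystar lam" for z
    using lagrangian_y_star_less[of z lam] lagrangian_le_objective[OF that(1) lam] that val
    by (simp add: primal_feasible_def)
  show "primal_optimal dt B L x \<tau> A y \<longleftrightarrow> y = ystar lam"
  proof
    assume "primal_optimal dt B L x \<tau> A y"
    then have "primal_feasible dt B L x \<tau> y" "\<not> primal_objective A (ystar lam) < primal_objective A y"
      using feas by (auto simp: primal_optimal_def is_arg_min_def)
    then show "y = ystar lam" using less by blast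
  next
    assume "y = ystar lam"
    moreover have "\<not> primal_objective A z < primal_objective A (ystar lam)"
      if "primal_feasible dt B L x \<tau> z" for z
      using less[OF that] by (cases "z = ystar lam") auto
    ultimately show "primal_optimal dt B L x \<tau> A y"
      using feas by (simp add: primal_optimal_def is_arg_min_def)
  qed
  have "dual nu \<le> primal_objective A (ystar lam)" if "nu \<ge> 0" for nu
    using dual_function_le[OF y_star_in_box, of nu lam] lagrangian_le_objective[OF feas that] by simp
  note weak = this
  have strong: "dual lam = primal_objective A (ystar lam)"
    using val by (simp add: dual_function_eq)
  show "dual_optimal dt B L x \<tau> A mu \<longleftrightarrow> mu \<ge> 0 \<and> dual mu = primal_objective A (ystar lam)"
    using weak[of mu] weak strong lam
    unfolding dual_optimal_def is_arg_max_linorder by fastforce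
qed

lemma dual_optimal_exists: "\<exists>lam. dual_optimal dt B L x \<tau> A lam"
proof -
  obtain lam where lam: "lam \<ge> 0" "load (ystar lam) \<le> B" "lam * (load (ystar lam) - B) = 0"
    by (rule exists_complementary_multiplier)
  then show ?thesis
    using complementary_multiplier(2)[OF lam, of lam] by (auto simp: dual_function_eq lagrangian_def)
qed

lemma primal_optimal_iff:
  assumes "dual_optimal dt B L x \<tau> A mu"
  shows "primal_optimal dt B L x \<tau> A y \<longleftrightarrow> y = ystar mu"
proof -
  obtain lam where lam: "lam \<ge> 0" "load (ystar lam) \<le> B" "lam * (load (ystar lam) - B) = 0"
    by (rule exists_complementary_multiplier)
  have mu: "mu \<ge> 0" "dual mu = primal_objective A (ystar lam)"
    using assms complementary_multiplier(2)[OF lam] by auto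
  have "primal_feasible dt B L x \<tau> (ystar lam)"
    using lam y_star_in_box by (simp add: primal_feasible_def)
  \<comment> \<open>For feasible \<open>ystar lam\<close> the Lagrangian at \<open>mu\<close> is at
    most the primal value, which is \<open>dual mu\<close>. Hence \<open>ystar lam\<close> also
    minimizes the Lagrangian at \<open>mu\<close>, and uniqueness identifies it with
    \<open>ystar mu\<close>.\<close>
  then have "lagr (ystar lam) mu \<le> lagr (ystar mu) mu"
    using lagrangian_le_objective mu by (simp add: dual_function_eq)
  then have "ystar lam = ystar mu"
    using lagrangian_y_star_less[OF y_star_in_box] by (metis not_less)
  then show ?thesis using complementary_multiplier(1)[OF lam] by simp
qed

section \<open>Passage to delivery rates\<close>

text \<open>The map from \<open>b\<close> to \<open>x + dt *\<^sub>R b\<close> is a bijection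
  between the two feasible sets, and the objectives agree up to sign and the constant sum of the
  \<open>A i (x $ i)\<close>.\<close>

lemma rate_optimal_iff:
  "rate_optimal dt B L x \<tau> A b \<longleftrightarrow> primal_optimal dt B L x \<tau> A (x + dt *\<^sub>R b)"
proof -
  have feas: "rate_feasible dt B L x \<tau> c \<longleftrightarrow> primal_feasible dt B L x \<tau> (x + dt *\<^sub>R c)" for c
  proof -
    have "load (x + dt *\<^sub>R c) = (\<Sum>i\<in>UNIV. L $ i * c $ i)"
      using dt_pos by (simp add: backhaul_load_def)
    moreover have "0 \<le> dt * c $ i \<longleftrightarrow> 0 \<le> c $ i" for i
      using dt_pos by (simp add: zero_le_mult_iff)
    ultimately show ?thesis
      by (simp add: rate_feasible_def primal_feasible_def in_box_def x_tilde_def mult.commute[of _ dt])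
  qed
  have obj: "rate_objective dt x A c = - primal_objective A (x + dt *\<^sub>R c) - (\<Sum>i\<in>UNIV. A i (x $ i))"
    for c
    by (simp add: rate_objective_def primal_objective_def sum_subtractf mult.commute)
  have "z = x + dt *\<^sub>R ((z - x) /\<^sub>R dt)" for z
    using dt_pos by simp
  then have "(\<forall>z. P z) \<longleftrightarrow> (\<forall>c. P (x + dt *\<^sub>R c))" for P
    by metis
  from this[of "\<lambda>z. primal_feasible dt B L x \<tau> z \<longrightarrow>
      primal_objective A (x + dt *\<^sub>R b) \<le> primal_objective A z"]
  show ?thesis
    by (simp add: rate_optimal_def primal_optimal_def is_arg_max_linorder is_arg_min_linorder feas obj)
qed

end

theorem theorem1:
  fixes dt B :: real
    and L x \<tau> :: "real ^ 'n"
    and A A' :: "'n \<Rightarrow> real \<Rightarrow> real"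
  assumes dt_pos: "dt > 0"
    and B_nonneg: "B \<ge> 0"
    and L_pos: "\<And>i. L $ i > 0"
    and x_range: "\<And>i. x $ i \<in> {0..1}"
    and tau_range: "\<And>i. \<tau> $ i \<in> {0<..<1}"
    and A_deriv: "\<And>i u. u \<in> {\<tau> $ i..1} \<Longrightarrow>
          (A i has_real_derivative A' i u) (at u within {\<tau> $ i..1})"
    and A_C1: "\<And>i. continuous_on {\<tau> $ i..1} (A' i)"
    and A_incr: "\<And>i. strict_mono_on {\<tau> $ i..1} (A i)"
    and A_conc: "\<And>i. strictly_concave_on {\<tau> $ i..1} (A i)"
    and B_ge: "B \<ge> B_min dt L x \<tau>"
  shows "(\<exists>lam. dual_optimal dt B L x \<tau> A lam) \<and>
    (\<forall>lam. dual_optimal dt B L x \<tau> A lam \<longrightarrow>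
       (\<forall>y. primal_optimal dt B L x \<tau> A y \<longleftrightarrow> y = y_star dt L x \<tau> A' lam) \<and>
       (\<forall>b. rate_optimal dt B L x \<tau> A b \<longleftrightarrow> b = b_star dt L x \<tau> A' lam)) \<and>
    (\<forall>y. primal_optimal dt B L x \<tau> A y \<and> backhaul_load dt L x y = B \<longrightarrow>
       (\<exists>lam. dual_optimal dt B L x \<tau> A lam \<and>
          backhaul_load dt L x (y_star dt L x \<tau> A' lam) = B))"
proof -
  interpret caching_problem dt B L x \<tau> A A'
    using assms by unfold_locales auto
  have b_star: "x + dt *\<^sub>R b = ystar lam \<longleftrightarrow> b = b_star dt L x \<tau> A' lam" for b lam
    using dt_pos by (auto simp: b_star_def vec_eq_iff field_simps)
  show ?thesis
  proof (intro conjI allI impI)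
    show "\<exists>lam. dual_optimal dt B L x \<tau> A lam" by (rule dual_optimal_exists)
  next
    fix lam b assume "dual_optimal dt B L x \<tau> A lam"
    then show "rate_optimal dt B L x \<tau> A b \<longleftrightarrow> b = b_star dt L x \<tau> A' lam"
      by (simp add: rate_optimal_iff primal_optimal_iff b_star)
  next
    fix y assume "primal_optimal dt B L x \<tau> A y \<and> load y = B"
    \<comment> \<open>Any dual-optimal multiplier serves: its \<open>ystar\<close> is the given
      primal optimum \<open>y\<close>, whose load is \<open>B\<close>.\<close>
    then show "\<exists>lam. dual_optimal dt B L x \<tau> A lam \<and> load (ystar lam) = B"
      using dual_optimal_exists primal_optimal_iff by metis
  qed (rule primal_optimal_iff)
qed

end
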